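(* For every integer $m\ge1$ we have the identity of distributions on $\mathbb{R}$ $$\sum_{n=0}^{+\infty}\delta_n=\frac12\delta_0+\mathbf{1}_{\mathbb{R}_+}+\sum_{l=1}^m\frac{B_{2l}}{(2l)!}\,\delta_0^{(2l-1)}+\frac{D^{2m}}{Dt^{2m}}K_{2m}(t,0).$$
   Context: $B_n$ are the Bernoulli numbers, $\mathbf{1}_{\mathbb{R}_+}$ is the indicator function of $[0,\infty)$, $\delta_a$ is the Dirac mass at $a$, $D/Dt$ is the distributional derivative on $\mathbb{R}$, and $$K_{2m}(t,0)=\Big(\sum_{k\in\mathbb{Z}\setminus\{0\}}\frac{e^{2\pi ikt}}{(2\pi ik)^{2m}}\Big)\mathbf{1}_{\mathbb{R}_+}.$$ *)

theory Defs
  imports "HOL-Analysis.Analysis" "HOL-Computational_Algebra.Formal_Power_Series"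
begin

section \<open>Test functions\<close>

definition vderiv :: "(real \<Rightarrow> complex) \<Rightarrow> real \<Rightarrow> complex" where
  "vderiv f = (\<lambda>t. vector_derivative f (at t))"

definition smooth :: "(real \<Rightarrow> complex) \<Rightarrow> bool" where
  "smooth f \<longleftrightarrow> (\<forall>n t. (vderiv ^^ n) f differentiable (at t))"

definition supp :: "(real \<Rightarrow> complex) \<Rightarrow> real set" where
  "supp f = closure {t. f t \<noteq> 0}"

lemma smooth_differentiable: "smooth f \<Longrightarrow> f differentiable (at t)"
  unfolding smooth_def by (metis funpow_0)

lemma smooth_vderiv: "smooth f \<Longrightarrow> smooth (vderiv f)"
  unfolding smooth_def by (metis funpow_Suc_right o_apply)

lemma smooth_funpow_vderiv: "smooth f \<Longrightarrow> smooth ((vderiv ^^ n) f)"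
  by (induction n) (auto intro: smooth_vderiv)

lemma vderiv_const: "vderiv (\<lambda>_. c) = (\<lambda>_. 0)"
  by (simp add: vderiv_def)

lemma funpow_vderiv_0: "(vderiv ^^ n) (\<lambda>_. 0) = (\<lambda>_. 0)"
  by (induction n) (auto simp: vderiv_const)

lemma vderiv_add:
  "smooth f \<Longrightarrow> smooth g \<Longrightarrow> vderiv (\<lambda>t. f t + g t) = (\<lambda>t. vderiv f t + vderiv g t)"
  by (simp add: vderiv_def smooth_differentiable)

lemma vderiv_cmult: "smooth f \<Longrightarrow> vderiv (\<lambda>t. c * f t) = (\<lambda>t. c * vderiv f t)"
  by (simp add: vderiv_def smooth_differentiable)

lemma funpow_vderiv_add:
  assumes "smooth f" "smooth g"
  shows "(vderiv ^^ n) (\<lambda>t. f t + g t) = (\<lambda>t. (vderiv ^^ n) f t + (vderiv ^^ n) g t)"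
  by (induction n) (simp_all add: assms vderiv_add smooth_funpow_vderiv)

lemma funpow_vderiv_cmult:
  assumes "smooth f"
  shows "(vderiv ^^ n) (\<lambda>t. c * f t) = (\<lambda>t. c * (vderiv ^^ n) f t)"
  by (induction n) (simp_all add: assms vderiv_cmult smooth_funpow_vderiv)

lemma smooth_0: "smooth (\<lambda>_. 0)"
  by (simp add: smooth_def funpow_vderiv_0)

lemma smooth_add: "smooth f \<Longrightarrow> smooth g \<Longrightarrow> smooth (\<lambda>t. f t + g t)"
  unfolding smooth_def[of "\<lambda>t. f t + g t"]
  by (simp add: funpow_vderiv_add smooth_differentiable smooth_funpow_vderiv)

lemma smooth_cmult: "smooth f \<Longrightarrow> smooth (\<lambda>t. c * f t)"
  unfolding smooth_def[of "\<lambda>t. c * f t"]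
  by (simp add: funpow_vderiv_cmult smooth_differentiable smooth_funpow_vderiv)

lemma supp_0: "supp (\<lambda>_. 0) = {}"
  by (simp add: supp_def)

lemma compact_supp_mono:
  assumes "compact (supp f)" "{t. g t \<noteq> 0} \<subseteq> supp f"
  shows "compact (supp g)" "supp g \<subseteq> supp f"
proof -
  show "supp g \<subseteq> supp f"
    using assms(2) by (simp add: supp_def closure_minimal)
  then show "compact (supp g)"
    using assms(1) by (metis Int_absorb2 closed_closure compact_Int_closed supp_def inf_commute)
qed

lemma vderiv_nonzero_supp: "{t. vderiv f t \<noteq> 0} \<subseteq> supp f"
proof (intro subsetI, rule ccontr)
  fix t assume t: "t \<in> {t. vderiv f t \<noteq> 0}" "t \<notin> supp f"
  then have "open (- supp f)" "t \<in> - supp f"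
    by (auto simp: supp_def)
  then have "\<forall>\<^sub>F x in nhds t. x \<in> - supp f"
    by (rule eventually_nhds_in_open)
  then have "\<forall>\<^sub>F x in nhds t. f x = 0"
    by eventually_elim (use closure_subset[of "{t. f t \<noteq> 0}"] in \<open>auto simp: supp_def\<close>)
  then have "vector_derivative f (at t) = vector_derivative (\<lambda>_. 0) (at t)"
    by (intro vector_derivative_cong_eq) auto
  with t show False by (simp add: vderiv_def)
qed

lemma compact_supp_vderiv:
  "compact (supp f) \<Longrightarrow> compact (supp (vderiv f))" "supp (vderiv f) \<subseteq> supp f"
proof -
  show "compact (supp f) \<Longrightarrow> compact (supp (vderiv f))"
    using compact_supp_mono(1)[OF _ vderiv_nonzero_supp] .
  show "supp (vderiv f) \<subseteq> supp f"
    using vderiv_nonzero_supp[of f] unfolding supp_def by (intro closure_minimal) auto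
qed

lemma compact_supp_add:
  assumes "compact (supp f)" "compact (supp g)"
  shows "compact (supp (\<lambda>t. f t + g t))"
proof -
  have "supp (\<lambda>t. f t + g t) \<subseteq> supp f \<union> supp g"
    unfolding supp_def closure_Un[symmetric] by (intro closure_mono) auto
  then show ?thesis
    using compact_Un[OF assms]
    by (metis closed_closure compact_Int_closed supp_def inf.absorb_iff2)
qed

lemma compact_supp_cmult: "compact (supp f) \<Longrightarrow> compact (supp (\<lambda>t. c * f t))"
  by (rule compact_supp_mono(1)[of f]) (use closure_subset[of "{t. f t \<noteq> 0}"] in \<open>auto simp: supp_def\<close>)

typedef test_fun = "{f. smooth f \<and> compact (supp f)}"
  morphisms tf_app Test_fun
  by (rule exI[of _ "\<lambda>_. 0"]) (simp add: smooth_0 supp_0)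

setup_lifting type_definition_test_fun

lemma smooth_tf: "smooth (tf_app \<phi>)" and compact_supp_tf: "compact (supp (tf_app \<phi>))"
  using tf_app[of \<phi>] by auto

lift_definition tf_scale :: "complex \<Rightarrow> test_fun \<Rightarrow> test_fun" is "\<lambda>c f t. c * f t"
  by (simp add: smooth_cmult compact_supp_cmult)

lift_definition tf_deriv :: "test_fun \<Rightarrow> test_fun" is vderiv
  by (simp add: smooth_vderiv compact_supp_vderiv)

instantiation test_fun :: ab_group_add
begin

lift_definition zero_test_fun :: test_fun is "\<lambda>_. 0"
  by (simp add: smooth_0 supp_0)

lift_definition plus_test_fun :: "test_fun \<Rightarrow> test_fun \<Rightarrow> test_fun" is "\<lambda>f g t. f t + g t"
  by (simp add: smooth_add compact_supp_add)

lift_definition uminus_test_fun :: "test_fun \<Rightarrow> test_fun" is "\<lambda>f t. - f t"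
  using smooth_cmult[of _ "-1"] compact_supp_cmult[of _ "-1"] by simp

lift_definition minus_test_fun :: "test_fun \<Rightarrow> test_fun \<Rightarrow> test_fun" is "\<lambda>f g t. f t - g t"
  using smooth_add[OF _ smooth_cmult[of _ "-1"]] compact_supp_add[OF _ compact_supp_cmult[of _ "-1"]]
  by simp

instance
  by standard (transfer; simp add: algebra_simps)+

end

lemma tf_deriv_add: "tf_deriv (\<phi> + \<psi>) = tf_deriv \<phi> + tf_deriv \<psi>"
  by transfer (simp add: vderiv_add)

lemma tf_deriv_scale: "tf_deriv (tf_scale c \<phi>) = tf_scale c (tf_deriv \<phi>)"
  by transfer (simp add: vderiv_cmult)

definition deriv_sup :: "nat \<Rightarrow> test_fun \<Rightarrow> real" where
  "deriv_sup k \<phi> = (SUP t. norm ((vderiv ^^ k) (tf_app \<phi>) t))"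

lemma bdd_above_tf: "bdd_above (range (\<lambda>t. norm (tf_app \<phi> t)))"
proof -
  have "continuous_on (supp (tf_app \<phi>)) (tf_app \<phi>)"
    by (meson continuous_at_imp_continuous_on differentiable_imp_continuous_within
        smooth_differentiable smooth_tf)
  then have "bounded (tf_app \<phi> ` supp (tf_app \<phi>))"
    by (intro compact_imp_bounded compact_continuous_image compact_supp_tf)
  then obtain B where B: "\<And>t. t \<in> supp (tf_app \<phi>) \<Longrightarrow> norm (tf_app \<phi> t) \<le> B"
    unfolding bounded_iff by auto
  have "norm (tf_app \<phi> t) \<le> max B 0" for t
    using B[of t] closure_subset[of "{t. tf_app \<phi> t \<noteq> 0}"]
    by (cases "tf_app \<phi> t = 0") (auto simp: supp_def)
  then show ?thesis by (auto intro!: bdd_aboveI)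
qed

lemma tf_app_funpow_deriv: "tf_app ((tf_deriv ^^ k) \<phi>) = (vderiv ^^ k) (tf_app \<phi>)"
  by (induction k) (simp_all add: tf_deriv.rep_eq)

lemma deriv_sup_upper: "norm ((vderiv ^^ k) (tf_app \<phi>) t) \<le> deriv_sup k \<phi>"
  unfolding deriv_sup_def
  by (rule cSUP_upper) (use bdd_above_tf[of "(tf_deriv ^^ k) \<phi>"] in \<open>auto simp: tf_app_funpow_deriv\<close>)

lemma deriv_sup_nonneg: "0 \<le> deriv_sup k \<phi>"
  using order_trans[OF norm_ge_zero deriv_sup_upper] .

lemma deriv_sup_deriv: "deriv_sup k (tf_deriv \<phi>) = deriv_sup (Suc k) \<phi>"
  by (simp add: deriv_sup_def tf_deriv.rep_eq funpow_Suc_right del: funpow.simps)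


section \<open>Distributions\<close>

(* Continuity on the space of test functions is expressed by the usual seminorm estimates on
   each compact set. *)
definition is_distribution :: "(test_fun \<Rightarrow> complex) \<Rightarrow> bool" where
  "is_distribution u \<longleftrightarrow>
     (\<forall>\<phi> \<psi>. u (\<phi> + \<psi>) = u \<phi> + u \<psi>) \<and>
     (\<forall>c \<phi>. u (tf_scale c \<phi>) = c * u \<phi>) \<and>
     (\<forall>K. compact K \<longrightarrow> (\<exists>C N. \<forall>\<phi>. supp (tf_app \<phi>) \<subseteq> K \<longrightarrow>
        norm (u \<phi>) \<le> C * (\<Sum>k\<le>N. deriv_sup k \<phi>)))"

lemma is_distributionI:
  assumes "\<And>\<phi> \<psi>. u (\<phi> + \<psi>) = u \<phi> + u \<psi>" "\<And>c \<phi>. u (tf_scale c \<phi>) = c * u \<phi>"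
    and "\<And>K. compact K \<Longrightarrow> \<exists>C N. \<forall>\<phi>. supp (tf_app \<phi>) \<subseteq> K \<longrightarrow>
        norm (u \<phi>) \<le> C * (\<Sum>k\<le>N. deriv_sup k \<phi>)"
  shows "is_distribution u"
  using assms unfolding is_distribution_def by blast

lemma is_distribution_bound:
  assumes "is_distribution u" "compact K"
  obtains C N where "C \<ge> 0" "\<And>\<phi> M. supp (tf_app \<phi>) \<subseteq> K \<Longrightarrow> N \<le> M \<Longrightarrow>
    norm (u \<phi>) \<le> C * (\<Sum>k\<le>M. deriv_sup k \<phi>)"
proof -
  obtain C N where C: "\<And>\<phi>. supp (tf_app \<phi>) \<subseteq> K \<Longrightarrow> norm (u \<phi>) \<le> C * (\<Sum>k\<le>N. deriv_sup k \<phi>)"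
    using assms unfolding is_distribution_def by blast
  show thesis
  proof (rule that[of "max C 0" N])
    fix \<phi> M assume "supp (tf_app \<phi>) \<subseteq> K" "N \<le> M"
    have "norm (u \<phi>) \<le> C * (\<Sum>k\<le>N. deriv_sup k \<phi>)"
      by (rule C) fact
    also have "\<dots> \<le> max C 0 * (\<Sum>k\<le>M. deriv_sup k \<phi>)"
      by (intro mult_mono sum_mono2 sum_nonneg) (use \<open>N \<le> M\<close> in \<open>auto simp: deriv_sup_nonneg\<close>)
    finally show "norm (u \<phi>) \<le> max C 0 * (\<Sum>k\<le>M. deriv_sup k \<phi>)" .
  qed simp
qed

lemma is_distribution_0: "is_distribution (\<lambda>_. 0)"
  by (rule is_distributionI) (auto intro!: exI[of _ 0])

lemma is_distribution_cmult:
  assumes "is_distribution u"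
  shows "is_distribution (\<lambda>\<phi>. c * u \<phi>)"
proof (rule is_distributionI)
  fix K :: "real set" assume "compact K"
  then obtain C N where "C \<ge> 0" and C: "\<And>\<phi> M. supp (tf_app \<phi>) \<subseteq> K \<Longrightarrow> N \<le> M \<Longrightarrow>
    norm (u \<phi>) \<le> C * (\<Sum>k\<le>M. deriv_sup k \<phi>)"
    using is_distribution_bound[OF assms] by metis
  show "\<exists>C N. \<forall>\<phi>. supp (tf_app \<phi>) \<subseteq> K \<longrightarrow> norm (c * u \<phi>) \<le> C * (\<Sum>k\<le>N. deriv_sup k \<phi>)"
    using C[of _ N] by (intro exI[of _ "norm c * C"] exI[of _ N])
       (simp add: norm_mult mult.assoc mult_left_mono)
qed (use assms in \<open>auto simp: is_distribution_def algebra_simps\<close>)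

lemma is_distribution_add:
  assumes "is_distribution u" "is_distribution v"
  shows "is_distribution (\<lambda>\<phi>. u \<phi> + v \<phi>)"
proof (rule is_distributionI)
  fix K :: "real set" assume K: "compact K"
  obtain C N where C: "\<And>\<phi> M. supp (tf_app \<phi>) \<subseteq> K \<Longrightarrow> N \<le> M \<Longrightarrow>
    norm (u \<phi>) \<le> C * (\<Sum>k\<le>M. deriv_sup k \<phi>)"
    using is_distribution_bound[OF assms(1) K] by metis
  obtain C' N' where C': "\<And>\<phi> M. supp (tf_app \<phi>) \<subseteq> K \<Longrightarrow> N' \<le> M \<Longrightarrow>
    norm (v \<phi>) \<le> C' * (\<Sum>k\<le>M. deriv_sup k \<phi>)"
    using is_distribution_bound[OF assms(2) K] by metis
  show "\<exists>C N. \<forall>\<phi>. supp (tf_app \<phi>) \<subseteq> K \<longrightarrow> norm (u \<phi> + v \<phi>) \<le> C * (\<Sum>k\<le>N. deriv_sup k \<phi>)"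
  proof (intro exI allI impI)
    fix \<phi> assume "supp (tf_app \<phi>) \<subseteq> K"
    then show "norm (u \<phi> + v \<phi>) \<le> (C + C') * (\<Sum>k\<le>max N N'. deriv_sup k \<phi>)"
      using norm_triangle_ineq[of "u \<phi>" "v \<phi>"] C[of \<phi> "max N N'"] C'[of \<phi> "max N N'"]
      by (simp add: distrib_right)
  qed
qed (use assms in \<open>auto simp: is_distribution_def algebra_simps\<close>)

typedef distribution = "{u. is_distribution u}"
  morphisms pairing Distribution
  using is_distribution_0 by blast

setup_lifting type_definition_distribution

instantiation distribution :: real_vector
begin

lift_definition zero_distribution :: distribution is "\<lambda>_. 0"
  by (rule is_distribution_0)

lift_definition plus_distribution :: "distribution \<Rightarrow> distribution \<Rightarrow> distribution"
  is "\<lambda>u v \<phi>. u \<phi> + v \<phi>"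
  by (rule is_distribution_add)

lift_definition uminus_distribution :: "distribution \<Rightarrow> distribution" is "\<lambda>u \<phi>. - u \<phi>"
  using is_distribution_cmult[of _ "-1"] by simp

lift_definition minus_distribution :: "distribution \<Rightarrow> distribution \<Rightarrow> distribution"
  is "\<lambda>u v \<phi>. u \<phi> - v \<phi>"
  using is_distribution_add[OF _ is_distribution_cmult[of _ "-1"]] by simp

lift_definition scaleR_distribution :: "real \<Rightarrow> distribution \<Rightarrow> distribution"
  is "\<lambda>r u \<phi>. complex_of_real r * u \<phi>"
  by (rule is_distribution_cmult)

instance
  by standard (transfer; simp add: algebra_simps)+

end

(* The weak topology: the coarsest one making every evaluation at a test function continuous.
   Infinite sums of distributions are taken in this topology. *)
instantiation distribution :: t2_space
begin

definition open_distribution :: "distribution set \<Rightarrow> bool" where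
  "open_distribution = generate_topology
     {{u. pairing u \<phi> \<in> U} | \<phi> U. open U}"

instance
proof
  show "open (UNIV :: distribution set)"
    unfolding open_distribution_def by (rule generate_topology.UNIV)
  show "open (S \<inter> T)" if "open S" "open T" for S T :: "distribution set"
    using that unfolding open_distribution_def by (rule generate_topology.Int)
  show "open (\<Union>\<K>)" if "\<forall>S\<in>\<K>. open S" for \<K> :: "distribution set set"
    unfolding open_distribution_def
    by (rule generate_topology.UN) (use that in \<open>simp add: open_distribution_def\<close>)
  fix u v :: distribution assume "u \<noteq> v"
  then obtain \<phi> where "pairing u \<phi> \<noteq> pairing v \<phi>"
    using pairing_inject by (auto simp: fun_eq_iff)
  then obtain U V where "open U" "open V" "pairing u \<phi> \<in> U" "pairing v \<phi> \<in> V" "U \<inter> V = {}"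
    using hausdorff by metis
  then show "\<exists>U V. open U \<and> open V \<and> u \<in> U \<and> v \<in> V \<and> U \<inter> V = {}"
    unfolding open_distribution_def
    by (intro exI[of _ "{u. pairing u \<phi> \<in> U}"] exI[of _ "{u. pairing u \<phi> \<in> V}"])
       (auto intro!: generate_topology.Basis)
qed

end

lemma tendsto_distribution_iff:
  "(f \<longlongrightarrow> u) F \<longleftrightarrow> (\<forall>\<phi>. ((\<lambda>x. pairing (f x) \<phi>) \<longlongrightarrow> pairing u \<phi>) F)"
proof safe
  fix \<phi> assume f: "(f \<longlongrightarrow> u) F"
  show "((\<lambda>x. pairing (f x) \<phi>) \<longlongrightarrow> pairing u \<phi>) F"
  proof (rule topological_tendstoI)
    fix U assume "open U" "pairing u \<phi> \<in> U"
    then have "open {u. pairing u \<phi> \<in> U}" "u \<in> {u. pairing u \<phi> \<in> U}"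
      unfolding open_distribution_def by (auto intro!: generate_topology.Basis)
    from topological_tendstoD[OF f this] show "\<forall>\<^sub>F x in F. pairing (f x) \<phi> \<in> U"
      by simp
  qed
next
  assume f: "\<forall>\<phi>. ((\<lambda>x. pairing (f x) \<phi>) \<longlongrightarrow> pairing u \<phi>) F"
  show "(f \<longlongrightarrow> u) F"
  proof (rule topological_tendstoI)
    fix S assume "open S" "u \<in> S"
    then show "\<forall>\<^sub>F x in F. f x \<in> S"
      unfolding open_distribution_def
    proof (induction rule: generate_topology.induct)
      case (Int A B)
      then show ?case by (simp add: eventually_conj)
    next
      case (UN \<K>)
      then obtain S where "S \<in> \<K>" "u \<in> S" by auto
      then have "\<forall>\<^sub>F x in F. f x \<in> S" by (rule UN.IH)
      then show ?case by eventually_elim (use \<open>S \<in> \<K>\<close> in auto)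
    next
      case (Basis S)
      then obtain \<phi> U where "open U" "pairing u \<phi> \<in> U" "S = {u. pairing u \<phi> \<in> U}" by auto
      then show ?case using topological_tendstoD[OF spec[OF f]] by simp
    qed simp
  qed
qed

lemma pairing_add: "pairing (u + v) \<phi> = pairing u \<phi> + pairing v \<phi>"
  by transfer simp

lemma pairing_scaleR: "pairing (r *\<^sub>R u) \<phi> = complex_of_real r * pairing u \<phi>"
  by transfer simp

lemma pairing_sum: "pairing (\<Sum>i\<in>I. f i) \<phi> = (\<Sum>i\<in>I. pairing (f i) \<phi>)"
  by (induction I rule: infinite_finite_induct) (simp_all add: pairing_add zero_distribution.rep_eq)

lemma sums_distribution_iff:
  "f sums u \<longleftrightarrow> (\<forall>\<phi>. (\<lambda>n. pairing (f n) \<phi>) sums pairing u \<phi>)"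
  by (simp add: sums_def tendsto_distribution_iff pairing_sum)

lift_definition dirac :: "real \<Rightarrow> distribution" is "\<lambda>a \<phi>. tf_app \<phi> a"
proof (rule is_distributionI)
  fix a :: real and K :: "real set"
  show "\<exists>C N. \<forall>\<phi>. supp (tf_app \<phi>) \<subseteq> K \<longrightarrow> norm (tf_app \<phi> a) \<le> C * (\<Sum>k\<le>N. deriv_sup k \<phi>)"
    using deriv_sup_upper[of 0] by (intro exI[of _ 1] exI[of _ 0]) simp
qed (simp_all add: plus_test_fun.rep_eq tf_scale.rep_eq)

lift_definition dist_deriv :: "distribution \<Rightarrow> distribution" is "\<lambda>u \<phi>. - u (tf_deriv \<phi>)"
proof (rule is_distributionI)
  fix u and K :: "real set" assume u: "is_distribution u" and K: "compact K"
  obtain C N where "C \<ge> 0" and C: "\<And>\<phi> M. supp (tf_app \<phi>) \<subseteq> K \<Longrightarrow> N \<le> M \<Longrightarrow>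
    norm (u \<phi>) \<le> C * (\<Sum>k\<le>M. deriv_sup k \<phi>)"
    using is_distribution_bound[OF u K] by metis
  have "norm (- u (tf_deriv \<phi>)) \<le> C * (\<Sum>k\<le>Suc N. deriv_sup k \<phi>)"
    if "supp (tf_app \<phi>) \<subseteq> K" for \<phi>
  proof -
    have "norm (- u (tf_deriv \<phi>)) \<le> C * (\<Sum>k\<le>N. deriv_sup k (tf_deriv \<phi>))"
      unfolding norm_minus_cancel
      by (rule C) (use that compact_supp_vderiv(2) in \<open>auto simp: tf_deriv.rep_eq\<close>)
    also have "\<dots> = C * (\<Sum>k\<le>N. deriv_sup (Suc k) \<phi>)"
      by (simp add: deriv_sup_deriv)
    also have "\<dots> \<le> C * (\<Sum>k\<le>Suc N. deriv_sup k \<phi>)"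
      by (intro mult_left_mono \<open>C \<ge> 0\<close>)
         (simp add: sum.atMost_Suc_shift deriv_sup_nonneg del: sum.atMost_Suc)
    finally show ?thesis .
  qed
  then show "\<exists>C N. \<forall>\<phi>. supp (tf_app \<phi>) \<subseteq> K \<longrightarrow>
      norm (- u (tf_deriv \<phi>)) \<le> C * (\<Sum>k\<le>N. deriv_sup k \<phi>)"
    by blast
qed (simp_all add: tf_deriv_add tf_deriv_scale is_distribution_def)

definition locally_integrable :: "(real \<Rightarrow> complex) \<Rightarrow> bool" where
  "locally_integrable f \<longleftrightarrow> (\<forall>C. compact C \<longrightarrow> f absolutely_integrable_on C)"

lemma locally_integrable_mult_tf:
  assumes f: "locally_integrable f"
  shows "integrable lebesgue (\<lambda>t. f t * tf_app \<phi> t)"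
    and "compact C \<Longrightarrow> supp (tf_app \<phi>) \<subseteq> C \<Longrightarrow>
      norm (LINT t|lebesgue. f t * tf_app \<phi> t) \<le> (LINT t:C|lebesgue. norm (f t)) * deriv_sup 0 \<phi>"
proof -
  have bound: "norm (f t * tf_app \<phi> t) \<le> norm (indicat_real C t *\<^sub>R f t) * deriv_sup 0 \<phi>"
    if "supp (tf_app \<phi>) \<subseteq> C" for C t
  proof (cases "t \<in> C")
    case True
    then show ?thesis
      using deriv_sup_upper[of 0 \<phi> t] by (simp add: norm_mult mult_left_mono)
  next
    case False
    then have "tf_app \<phi> t = 0"
      using that closure_subset[of "{t. tf_app \<phi> t \<noteq> 0}"] by (auto simp: supp_def)
    then show ?thesis using False by simp
  qed
  have int: "integrable lebesgue (\<lambda>t. indicat_real C t *\<^sub>R f t)" if "compact C" for C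
    using f that by (simp add: locally_integrable_def set_integrable_def)
  have cont: "continuous_on UNIV (tf_app \<phi>)"
    by (meson continuous_at_imp_continuous_on differentiable_imp_continuous_within
        smooth_differentiable smooth_tf)
  let ?S = "supp (tf_app \<phi>)"
  have "(\<lambda>t. (indicat_real ?S t *\<^sub>R f t) * tf_app \<phi> t) \<in> borel_measurable lebesgue"
  proof (rule borel_measurable_times)
    show "(\<lambda>t. indicat_real ?S t *\<^sub>R f t) \<in> borel_measurable lebesgue"
      using int[OF compact_supp_tf] by (rule borel_measurable_integrable)
    show "tf_app \<phi> \<in> borel_measurable lebesgue"
      by (intro measurable_completion) (simp add: borel_measurable_continuous_onI cont)
  qed
  also have "(\<lambda>t. (indicat_real ?S t *\<^sub>R f t) * tf_app \<phi> t) = (\<lambda>t. f t * tf_app \<phi> t)"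
    using closure_subset[of "{t. tf_app \<phi> t \<noteq> 0}"]
    by (intro ext) (auto simp: supp_def indicator_def)
  finally have meas: "(\<lambda>t. f t * tf_app \<phi> t) \<in> borel_measurable lebesgue" .
  have dom: "integrable lebesgue (\<lambda>t. norm (indicat_real C t *\<^sub>R f t) * deriv_sup 0 \<phi>)"
    if "compact C" for C
    using int[OF that] by (intro integrable_mult_left integrable_norm)
  show intg: "integrable lebesgue (\<lambda>t. f t * tf_app \<phi> t)"
    by (rule Bochner_Integration.integrable_bound
          [where f = "\<lambda>t. norm (indicat_real ?S t *\<^sub>R f t) * deriv_sup 0 \<phi>"])
       (use dom[OF compact_supp_tf] meas bound[of ?S] deriv_sup_nonneg[of 0 \<phi>]
         in \<open>simp_all add: abs_mult\<close>)
  assume C: "compact C" "supp (tf_app \<phi>) \<subseteq> C"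
  have "norm (LINT t|lebesgue. f t * tf_app \<phi> t) \<le> (LINT t|lebesgue. norm (indicat_real C t *\<^sub>R f t) * deriv_sup 0 \<phi>)"
    by (rule Bochner_Integration.integral_norm_bound_integral[OF intg])
       (use dom[OF C(1)] bound[OF C(2)] in simp_all)
  also have "\<dots> = (LINT t:C|lebesgue. norm (f t)) * deriv_sup 0 \<phi>"
    by (simp add: set_lebesgue_integral_def)
  finally show "norm (LINT t|lebesgue. f t * tf_app \<phi> t) \<le> (LINT t:C|lebesgue. norm (f t)) * deriv_sup 0 \<phi>" .
qed

(* The distribution given by a locally integrable function; the value 0 for other functions
   only makes the definition total. *)
lift_definition regular_dist :: "(real \<Rightarrow> complex) \<Rightarrow> distribution" is
  "\<lambda>f \<phi>. if locally_integrable f then (LINT t|lebesgue. f t * tf_app \<phi> t) else 0"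
proof -
  fix f :: "real \<Rightarrow> complex"
  show "is_distribution (\<lambda>\<phi>. if locally_integrable f
          then (LINT t|lebesgue. f t * tf_app \<phi> t) else 0)"
  proof (cases "locally_integrable f")
    case True
    have "is_distribution (\<lambda>\<phi>. LINT t|lebesgue. f t * tf_app \<phi> t)"
    proof (rule is_distributionI)
      fix \<phi> \<psi>
      show "(LINT t|lebesgue. f t * tf_app (\<phi> + \<psi>) t) =
            (LINT t|lebesgue. f t * tf_app \<phi> t) + (LINT t|lebesgue. f t * tf_app \<psi> t)"
        by (simp add: plus_test_fun.rep_eq distrib_left locally_integrable_mult_tf(1)[OF True])
    next
      fix c \<phi>
      show "(LINT t|lebesgue. f t * tf_app (tf_scale c \<phi>) t) = c * (LINT t|lebesgue. f t * tf_app \<phi> t)"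
        by (simp add: tf_scale.rep_eq mult.left_commute)
    next
      fix K :: "real set" assume "compact K"
      then show "\<exists>C N. \<forall>\<phi>. supp (tf_app \<phi>) \<subseteq> K \<longrightarrow>
          norm (LINT t|lebesgue. f t * tf_app \<phi> t) \<le> C * (\<Sum>k\<le>N. deriv_sup k \<phi>)"
        using locally_integrable_mult_tf(2)[OF True]
        by (intro exI[of _ "LINT t:K|lebesgue. norm (f t)"] exI[of _ 0]) auto
    qed
    then show ?thesis using True by simp
  qed (simp add: is_distribution_0)
qed


section \<open>Bernoulli numbers and the kernel\<close>

(* Normalisation: x / (exp x - 1) = sum of B_n x^n / n! *)
definition bernoulli :: "nat \<Rightarrow> real" where
  "bernoulli n = fact n * fps_nth (fps_X / (fps_exp 1 - 1)) n"

lemma bernoulli_generating_function: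
  "Abs_fps (\<lambda>n. bernoulli n / fact n) * (fps_exp 1 - 1) = fps_X"
proof -
  have nz: "fps_nth (fps_exp 1 - 1 :: real fps) 1 \<noteq> 0"
    by simp
  then have "subdegree (fps_exp 1 - 1 :: real fps) \<le> 1"
    by (rule subdegree_leI)
  then have "(fps_exp 1 - 1 :: real fps) dvd fps_X"
    using nz by (subst fps_dvd_iff) auto
  moreover have "Abs_fps (\<lambda>n. bernoulli n / fact n) = fps_X / (fps_exp 1 - 1)"
    by (simp add: fps_eq_iff bernoulli_def)
  ultimately show ?thesis
    by simp
qed

(* This is K_n(t,0); the sum converges absolutely for n at least 2. *)
definition periodic_kernel :: "nat \<Rightarrow> real \<Rightarrow> complex" where
  "periodic_kernel n t =
     (\<Sum>\<^sub>\<infinity>k\<in>UNIV - {0::int}. exp (2 * pi * \<i> * of_int k * t) / (2 * pi * \<i> * of_int k) ^ n)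
       * indicator {0..} t"

end

theory Submission
  imports Defs
begin

text \<open>
  Tested against a function \<open>\<phi>\<close> with compact support, the identity is the Euler-Maclaurin formula
  for \<open>\<Sum>\<^sub>n \<phi>(n)\<close> on the half line. Every distributional derivative moves to \<open>\<phi>\<close> with a minus sign, so the
  derivatives of \<open>\<delta>\<^sub>0\<close>, which have odd order, contribute with a minus sign, and the even derivative
  of the kernel becomes the remainder integral of the kernel against \<open>\<phi>\<^sup>(\<^sup>2\<^sup>m\<^sup>)\<close>.

  Write \<open>K\<^sub>n(t)\<close> for the sum of \<open>exp (2 \<pi> i k t) / (2 \<pi> i k)\<^sup>n\<close> over the nonzero integers \<open>k\<close>. The formula
  follows by repeated integration by parts from three facts: \<open>K\<^sub>n\<^sub>+\<^sub>1\<close> is an antiderivative of \<open>K\<^sub>n\<close> for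
  \<open>n \<ge> 2\<close>, \<open>K\<^sub>n(0) = 0\<close> for odd \<open>n\<close>, and \<open>K\<^sub>n = - B\<^sub>n(t) / n!\<close> on \<open>[0, 1]\<close>
  for \<open>n \<ge> 2\<close>
  (\<open>kernel_series_eq_bernoulli_poly\<close>), which provides the value \<open>K\<^sub>n(0) = - B\<^sub>n / n!\<close>
  and starts the integrations by parts at \<open>n = 2\<close>, where the kernel is continuous but not differentiable
  at the integers (\<open>euler_maclaurin_order_2\<close>).

  The Fourier expansion of the Bernoulli polynomials is proved without any general
  convergence theorem. For \<open>n = 2\<close>, the partial sums of \<open>\<Sum> sin (k t) / k\<close> are compared
  with \<open>(\<pi> - t) / 2\<close> by means of the Dirichlet kernel (\<open>sawtooth_partial_sum_bound\<close>); one integration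
  determines \<open>\<Sum> cos (k t) / k\<^sup>2\<close> up to a constant. For larger \<open>n\<close>, both sides of the expansion are
  antiderivatives of those for \<open>n - 1\<close>. In all cases the constant of integration is zero because
  the antiderivatives of both sides are periodic
  (\<open>kernel_series_plus_bernoulli_poly_constant\<close>).
\<close>

section \<open>The cosine series with inverse squares\<close>

lemma sum_cos_times_sin_half:
  "2 * sin (t / 2) * (\<Sum>k<N. cos (real (Suc k) * t)) = sin ((real N + 1/2) * t) - sin (t / 2)"
proof (induction N)
  case (Suc N)
  have "sin ((real (Suc N) + 1/2) * t) - sin ((real N + 1/2) * t)
      = sin (real (Suc N) * t + t / 2) - sin (real (Suc N) * t - t / 2)"
    by (simp add: algebra_simps add_divide_distrib)
  also have "\<dots> = 2 * sin (t / 2) * cos (real (Suc N) * t)"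
    unfolding sin_add sin_diff by simp
  finally show ?case
    using Suc by (simp add: distrib_left del: of_nat_Suc)
qed simp

text \<open>The error of the partial sum has derivative \<open>sin ((N + 1/2) t) / (2 sin (t / 2))\<close>, the Dirichlet
  kernel. One integration by parts gains the factor \<open>1 / (N + 1/2)\<close>, and on \<open>[x, pi]\<close>, away from the
  zero of \<open>sin (t / 2)\<close>, everything else stays bounded. All error terms vanish at \<open>pi\<close>, so the mean
  value inequality turns the bound on the derivative into one on the error.\<close>

lemma sawtooth_partial_sum_bound:
  assumes x: "0 < x" and t: "x \<le> t" "t \<le> pi"
  defines "s \<equiv> sin (x / 2)"
  shows "\<bar>(\<Sum>k<N. sin (real (Suc k) * t) / real (Suc k)) - (pi - t) / 2\<bar>
      \<le> (pi / (4 * s^2) + 1 / (2 * s)) / (real N + 1/2)"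
proof -
  define a where "a = real N + 1/2"
  have a: "a > 0" by (simp add: a_def)
  have s: "s > 0"
    unfolding s_def using x t by (intro sin_gt_zero) auto
  have sin_ge: "s \<le> sin (u / 2)" if "u \<in> {x..pi}" for u
    unfolding s_def using x that by (intro sin_monotone_2pi_le) auto
  \<comment> \<open>The error plus the boundary term of that integration by parts: its derivative is
    the new integrand, which is already of size \<open>1 / a\<close>.\<close>
  define E where "E u = (\<Sum>k<N. sin (real (Suc k) * u) / real (Suc k)) - (pi - u) / 2
    + cos (a * u) / (2 * a * sin (u / 2))" for u
  define E' where "E' u = - cos (a * u) * cos (u / 2) / (4 * a * (sin (u / 2))^2)" for u
  have deriv: "(E has_real_derivative E' u) (at u within {x..pi})" if u: "u \<in> {x..pi}" for u
  proof -
    have nz: "sin (u / 2) \<noteq> 0" using sin_ge[OF u] s by auto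
    have "(E has_real_derivative ((\<Sum>k<N. cos (real (Suc k) * u)) + 1/2
         + ((- sin (a * u) * a) * (2 * a * sin (u / 2)) - cos (a * u) * (2 * a * (cos (u / 2) * (1/2))))
            / (2 * a * sin (u / 2))^2)) (at u within {x..pi})"
      unfolding E_def using nz a
      by (auto intro!: derivative_eq_intros sum.cong simp: power2_eq_square simp del: of_nat_Suc)
    moreover have "(\<Sum>k<N. cos (real (Suc k) * u)) = sin (a * u) / (2 * sin (u / 2)) - 1/2"
    proof -
      have "X = p / (2 * S) - 1/2" if "2 * S * X = p - S" "S \<noteq> 0" for X p S :: real
        using that by (simp add: field_simps)
      from this[OF sum_cos_times_sin_half nz] show ?thesis unfolding a_def .
    qed
    moreover have "sin (a * u) / (2 * sin (u / 2)) - 1/2 + 1/2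
         + ((- sin (a * u) * a) * (2 * a * sin (u / 2)) - cos (a * u) * (2 * a * (cos (u / 2) * (1/2))))
            / (2 * a * sin (u / 2))^2 = E' u"
    proof -
      have "p / (2 * S) - 1/2 + 1/2 + ((- p * a) * (2 * a * S) - q * (2 * a * (c * (1/2)))) / (2 * a * S)^2
          = - q * c / (4 * a * S^2)" if "S \<noteq> 0" for p q c S :: real
        using that a by (simp add: diff_divide_distrib power2_eq_square)
      from this[OF nz] show ?thesis unfolding E'_def .
    qed
    ultimately show ?thesis by (simp only:)
  qed
  have bound: "\<bar>E' u\<bar> \<le> 1 / (4 * a * s^2)" if u: "u \<in> {x..pi}" for u
  proof -
    have "\<bar>E' u\<bar> = (\<bar>cos (a * u)\<bar> * \<bar>cos (u / 2)\<bar>) / (4 * a * (sin (u / 2))^2)"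
      using a by (simp add: E'_def abs_mult)
    also have "\<dots> \<le> (1 * 1) / (4 * a * s^2)"
      using a s sin_ge[OF u] by (intro frac_le mult_mono power_mono) auto
    finally show ?thesis by simp
  qed
  have "norm (E t - E pi) \<le> 1 / (4 * a * s^2) * norm (t - pi)"
    by (rule field_differentiable_bound[of "{x..pi}" E E']) (use deriv bound x t in auto)
  also have "\<dots> \<le> 1 / (4 * a * s^2) * pi"
    using x t a by (intro mult_left_mono) auto
  finally have "\<bar>E t - E pi\<bar> \<le> pi / (4 * a * s^2)" by simp
  moreover have "cos (a * pi) = 0"
    unfolding a_def by (simp add: distrib_right cos_add)
  then have "E pi = 0"
    by (simp add: E_def del: of_nat_Suc)
  moreover have "\<bar>cos (a * t) / (2 * a * sin (t / 2))\<bar> \<le> 1 / (2 * a * s)"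
    unfolding abs_divide using a s sin_ge[of t] t by (intro frac_le) auto
  ultimately have "\<bar>(\<Sum>k<N. sin (real (Suc k) * t) / real (Suc k)) - (pi - t) / 2\<bar>
      \<le> pi / (4 * a * s^2) + 1 / (2 * a * s)"
    unfolding E_def by linarith
  also have "\<dots> = (pi / (4 * s^2) + 1 / (2 * s)) / a"
    by (simp add: add_divide_distrib mult_ac)
  finally show ?thesis by (simp add: a_def)
qed

lemma summable_inverse_Suc_squares: "summable (\<lambda>k. 1 / (real (Suc k))\<^sup>2)"
  using inverse_squares_sums by (simp add: sums_iff add.commute)

lemma summable_cos_over_squares: "summable (\<lambda>k. cos (real (Suc k) * x) / (real (Suc k))\<^sup>2)"
  by (rule summable_comparison_test'[OF summable_inverse_Suc_squares])
     (simp add: divide_right_mono del: of_nat_Suc)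

text \<open>Integrating the uniform convergence of the sawtooth series on \<open>[x, pi]\<close> identifies the cosine
  series up to its value at \<open>pi\<close>. That value is left undetermined here: periodicity of the next
  antiderivative fixes it later.\<close>

lemma suminf_cos_over_squares_half:
  assumes x: "0 < x" "x \<le> pi"
  shows "(\<Sum>k. cos (real (Suc k) * x) / (real (Suc k))\<^sup>2)
    = (x - pi)\<^sup>2 / 4 + (\<Sum>k. cos (real (Suc k) * pi) / (real (Suc k))\<^sup>2)"
proof -
  define F where "F N t = (\<Sum>k<N. cos (real (Suc k) * t) / (real (Suc k))\<^sup>2)" for N t
  define H where "H N t = F N t - (t - pi)\<^sup>2 / 4" for N t
  define C where "C = pi / (4 * (sin (x / 2))^2) + 1 / (2 * sin (x / 2))"
  have C: "C \<ge> 0"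
    unfolding C_def using x by (intro add_nonneg_nonneg divide_nonneg_nonneg) (auto intro!: sin_ge_zero)
  have deriv: "(H N has_real_derivative
       - ((\<Sum>k<N. sin (real (Suc k) * t) / real (Suc k)) - (pi - t) / 2)) (at t within {x..pi})" for N t
  proof -
    have "((\<lambda>t. cos (real (Suc k) * t) / (real (Suc k))\<^sup>2) has_real_derivative
        - (sin (real (Suc k) * t) / real (Suc k))) (at t within {x..pi})" for k
      by (auto intro!: derivative_eq_intros simp: power2_eq_square simp del: of_nat_Suc)
    moreover have "((\<lambda>t. (t - pi)\<^sup>2 / 4) has_real_derivative - ((pi - t) / 2)) (at t within {x..pi})"
      by (auto intro!: derivative_eq_intros simp: field_simps)
    ultimately have "(H N has_real_derivative
        (\<Sum>k<N. - (sin (real (Suc k) * t) / real (Suc k))) - - ((pi - t) / 2)) (at t within {x..pi})"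
      unfolding H_def F_def by (intro DERIV_diff DERIV_sum)
    then show ?thesis by (simp add: sum_negf del: of_nat_Suc)
  qed
  have "norm (H N x - H N pi) \<le> C / (real N + 1/2) * norm (x - pi)" for N
    by (rule field_differentiable_bound[where S = "{x..pi}", OF _ deriv])
       (use x sawtooth_partial_sum_bound[of x _ N] in \<open>auto simp: C_def abs_minus_commute\<close>)
  moreover have "C / (real N + 1/2) * norm (x - pi) \<le> C / (real N + 1/2) * pi" for N
    using x C by (intro mult_left_mono) auto
  ultimately have le: "norm (H N x - H N pi) \<le> C / (real N + 1/2) * pi" for N
    by (rule order_trans)
  have "(\<lambda>N. C / (1/2 + real N) * pi) \<longlonglongrightarrow> 0"
    by (intro tendsto_mult_left_zero tendsto_divide_0[OF tendsto_const]
        filterlim_at_top_imp_at_infinity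
        filterlim_tendsto_add_at_top[OF tendsto_const filterlim_real_sequentially])
  then have "(\<lambda>N. C / (real N + 1/2) * pi) \<longlonglongrightarrow> 0"
    by (simp only: add.commute)
  then have "(\<lambda>N. H N x - H N pi) \<longlonglongrightarrow> 0"
    by (rule Lim_null_comparison[OF always_eventually[OF allI[OF le]]])
  moreover have "(\<lambda>N. H N x - H N pi) \<longlonglongrightarrow>
     ((\<Sum>k. cos (real (Suc k) * x) / (real (Suc k))\<^sup>2) - (x - pi)\<^sup>2 / 4)
     - ((\<Sum>k. cos (real (Suc k) * pi) / (real (Suc k))\<^sup>2) - (pi - pi)\<^sup>2 / 4)"
    unfolding H_def F_def
    by (intro tendsto_diff tendsto_const summable_LIMSEQ summable_cos_over_squares)
  ultimately have "((\<Sum>k. cos (real (Suc k) * x) / (real (Suc k))\<^sup>2) - (x - pi)\<^sup>2 / 4)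
     - ((\<Sum>k. cos (real (Suc k) * pi) / (real (Suc k))\<^sup>2) - (pi - pi)\<^sup>2 / 4) = 0"
    by (rule LIMSEQ_unique[THEN sym])
  then show ?thesis
    by (simp del: of_nat_Suc)
qed

lemma suminf_cos_over_squares:
  assumes x: "0 < x" "x < 2 * pi"
  shows "(\<Sum>k. cos (real (Suc k) * x) / (real (Suc k))\<^sup>2)
    = (x - pi)\<^sup>2 / 4 + (\<Sum>k. cos (real (Suc k) * pi) / (real (Suc k))\<^sup>2)"
proof (cases "x \<le> pi")
  case False
  have cos_eq: "cos (real (Suc k) * (2 * pi - x)) = cos (real (Suc k) * x)" for k
  proof -
    have "real (Suc k) * (2 * pi - x) = 2 * real (Suc k) * pi - real (Suc k) * x"
      by (simp add: algebra_simps)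
    then show ?thesis
      by (simp add: cos_diff cos_2npi sin_2npi del: of_nat_Suc)
  qed
  have sq_eq: "(2 * pi - x - pi)\<^sup>2 = (x - pi)\<^sup>2"
    by (simp add: power2_eq_square algebra_simps)
  show ?thesis
    using suminf_cos_over_squares_half[of "2 * pi - x"] x False unfolding cos_eq sq_eq by linarith
qed (use x suminf_cos_over_squares_half in blast)

section \<open>The kernels as Fourier series\<close>

abbreviation freq :: "nat \<Rightarrow> real" where
  "freq k \<equiv> 2 * pi * real (Suc k)"

text \<open>The modes \<open>k + 1\<close> and \<open>-(k + 1)\<close> of the kernel are taken together; this turns the sum over
  \<open>\<int> - {0}\<close> into an ordinary series.\<close>

definition kernel_term :: "nat \<Rightarrow> nat \<Rightarrow> real \<Rightarrow> complex" where
  "kernel_term n k t =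
     (cis (freq k * t) + (-1) ^ n * cis (- (freq k * t))) / (\<i> * of_real (freq k)) ^ n"

definition kernel_series :: "nat \<Rightarrow> real \<Rightarrow> complex" where
  "kernel_series n t = (\<Sum>k. kernel_term n k t)"

lemma inverse_freq_power_le:
  assumes "n \<ge> 2"
  shows "1 / (freq k) ^ n \<le> 1 / (real (Suc k))\<^sup>2"
proof -
  have ge: "real (Suc k) \<le> freq k"
    using pi_ge_two by (simp add: mult_le_cancel_right1 del: of_nat_Suc)
  have "(real (Suc k))\<^sup>2 \<le> (freq k)\<^sup>2"
    using ge by (intro power_mono) auto
  also have "\<dots> \<le> freq k ^ n"
    using assms ge by (intro power_increasing) linarith+
  finally show ?thesis
    by (intro divide_left_mono) auto
qed

lemma norm_kernel_term_le:
  assumes "n \<ge> 2"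
  shows "norm (kernel_term n k t) \<le> 2 * (1 / (real (Suc k))\<^sup>2)"
proof -
  have "norm (kernel_term n k t)
      = norm (cis (freq k * t) + (-1) ^ n * cis (- (freq k * t))) / freq k ^ n"
    by (simp add: kernel_term_def norm_divide norm_power norm_mult del: of_nat_Suc)
  also have "\<dots> \<le> 2 / freq k ^ n"
    by (intro divide_right_mono order_trans[OF norm_triangle_ineq])
       (simp_all add: norm_mult norm_power del: of_nat_Suc)
  also have "\<dots> = 2 * (1 / freq k ^ n)"
    by simp
  also have "\<dots> \<le> 2 * (1 / (real (Suc k))\<^sup>2)"
    by (intro mult_left_mono inverse_freq_power_le assms) simp
  finally show ?thesis .
qed

lemma uniform_limit_kernel_series:
  "n \<ge> 2 \<Longrightarrow> uniform_limit UNIV (\<lambda>N t. \<Sum>k<N. kernel_term n k t) (kernel_series n) sequentially"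
  unfolding kernel_series_def
  by (intro Weierstrass_m_test[where M = "\<lambda>k. 2 * (1 / (real (Suc k))\<^sup>2)"]
      norm_kernel_term_le summable_mult summable_inverse_Suc_squares)

lemma summable_norm_kernel_term: "n \<ge> 2 \<Longrightarrow> summable (\<lambda>k. norm (kernel_term n k t))"
  by (rule summable_comparison_test'[OF summable_mult[OF summable_inverse_Suc_squares]])
     (unfold real_norm_def abs_norm_cancel, erule norm_kernel_term_le)

lemma kernel_term_sums: "n \<ge> 2 \<Longrightarrow> (\<lambda>k. kernel_term n k t) sums kernel_series n t"
  unfolding kernel_series_def by (rule summable_sums[OF summable_norm_cancel[OF summable_norm_kernel_term]])

lemma has_vector_derivative_kernel_term:
  "(kernel_term (Suc n) k has_vector_derivative kernel_term n k t) (at t)"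
proof -
  have "((\<lambda>t. (cis (w * t) + (-1) ^ Suc n * cis (- (w * t))) / (\<i> * of_real w) ^ Suc n)
      has_vector_derivative (cis (w * t) + (-1) ^ n * cis (- (w * t))) / (\<i> * of_real w) ^ n) (at t)"
    if "w \<noteq> 0" for w :: real
  proof -
    have "((\<lambda>t. cis (w * t)) has_vector_derivative \<i> * of_real w * cis (w * t)) (at t)"
      and "((\<lambda>t. cis (- (w * t))) has_vector_derivative - \<i> * of_real w * cis (- (w * t))) (at t)"
      unfolding has_vector_derivative_def
      by (auto intro!: derivative_eq_intros simp: fun_eq_iff scaleR_conv_of_real)
    then have "((\<lambda>t. (cis (w * t) + (-1) ^ Suc n * cis (- (w * t))) / (\<i> * of_real w) ^ Suc n)
        has_vector_derivative
          (\<i> * of_real w * cis (w * t) + (-1) ^ Suc n * (- \<i> * of_real w * cis (- (w * t))))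
            / (\<i> * of_real w) ^ Suc n) (at t)"
      by (intro has_vector_derivative_divide has_vector_derivative_add has_vector_derivative_mult_right)
    also have "\<i> * of_real w * cis (w * t) + (-1) ^ Suc n * (- \<i> * of_real w * cis (- (w * t)))
        = \<i> * of_real w * (cis (w * t) + (-1) ^ n * cis (- (w * t)))"
      by (simp add: algebra_simps)
    finally show ?thesis
      using that by simp
  qed
  from this[of "freq k"] show ?thesis
    unfolding kernel_term_def[abs_def] by (simp del: of_nat_Suc power_Suc)
qed

text \<open>Differentiating lowers the exponent of the denominator by one, and for \<open>n \<ge> 2\<close> the
  differentiated series still converges uniformly.\<close>

lemma has_vector_derivative_kernel_series:
  assumes "n \<ge> 2"
  shows "(kernel_series (Suc n) has_vector_derivative kernel_series n t) (at t)"
proof -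
  have "\<exists>g. \<forall>x\<in>UNIV. (\<lambda>k. kernel_term (Suc n) k x) sums g x \<and>
      (g has_derivative (\<lambda>h. h *\<^sub>R kernel_series n x)) (at x within UNIV)"
  proof (rule has_derivative_series)
    show "(kernel_term (Suc n) k has_derivative (\<lambda>h. h *\<^sub>R kernel_term n k x)) (at x within UNIV)" for k x
      using has_vector_derivative_kernel_term by (simp add: has_vector_derivative_def)
    show "(\<lambda>k. kernel_term (Suc n) k 0) sums kernel_series (Suc n) 0"
      using assms by (intro kernel_term_sums) simp
    fix e :: real assume "e > 0"
    then have "\<forall>\<^sub>F N in sequentially. \<forall>x\<in>UNIV. dist (\<Sum>k<N. kernel_term n k x) (kernel_series n x) < e"
      using uniform_limit_kernel_series[OF assms] unfolding uniform_limit_iff by blast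
    then show "\<forall>\<^sub>F N in sequentially. \<forall>x\<in>UNIV. \<forall>h.
        norm ((\<Sum>k<N. h *\<^sub>R kernel_term n k x) - h *\<^sub>R kernel_series n x) \<le> e * norm h"
    proof eventually_elim
      case (elim N)
      show ?case
      proof (intro ballI allI)
        fix x h :: real
        have "norm ((\<Sum>k<N. h *\<^sub>R kernel_term n k x) - h *\<^sub>R kernel_series n x)
            = \<bar>h\<bar> * norm ((\<Sum>k<N. kernel_term n k x) - kernel_series n x)"
          by (simp flip: scaleR_sum_right scaleR_diff_right)
        also have "\<dots> \<le> \<bar>h\<bar> * e"
          using elim by (intro mult_left_mono) (auto simp: dist_norm intro: less_imp_le)
        finally show "norm ((\<Sum>k<N. h *\<^sub>R kernel_term n k x) - h *\<^sub>R kernel_series n x) \<le> e * norm h"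
          by (simp add: mult.commute)
      qed
    qed
  qed auto
  then obtain g where g: "\<And>x. (\<lambda>k. kernel_term (Suc n) k x) sums g x"
      "\<And>x. (g has_derivative (\<lambda>h. h *\<^sub>R kernel_series n x)) (at x)"
    by auto
  have "g = kernel_series (Suc n)"
    using g(1) by (auto simp: kernel_series_def sums_iff)
  with g(2) show ?thesis
    by (simp add: has_vector_derivative_def)
qed

lemma continuous_on_kernel_series:
  assumes "n \<ge> 2"
  shows "continuous_on A (kernel_series n)"
proof -
  have "continuous_on UNIV (kernel_series n)"
    by (rule uniform_limit_theorem[OF _ uniform_limit_kernel_series[OF assms]])
       (auto intro!: always_eventually continuous_intros simp: kernel_term_def simp del: of_nat_Suc)
  then show ?thesis
    by (rule continuous_on_subset) simp
qed

lemma kernel_series_add_of_nat: "kernel_series n (t + real j) = kernel_series n t"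
proof -
  have "cis (freq k * real j) = 1" for k
  proof -
    have "freq k * real j = 2 * pi * real (Suc k * j)"
      by (simp only: of_nat_mult mult.assoc)
    then show ?thesis
      by (metis Ints_of_nat cis_multiple_2pi)
  qed
  then have "kernel_term n k (t + real j) = kernel_term n k t" for k
    unfolding kernel_term_def distrib_left minus_add_distrib cis_mult[symmetric] cis_cnj[symmetric] by simp
  then show ?thesis
    by (simp add: kernel_series_def)
qed

text \<open>For odd \<open>n\<close> the contributions of opposite frequencies at \<open>0\<close> cancel. This is why only the odd
  derivatives of \<open>\<delta>\<^sub>0\<close>, with even Bernoulli numbers, survive in the final formula.\<close>

lemma kernel_series_odd_0: "odd n \<Longrightarrow> kernel_series n 0 = 0"
  by (simp add: kernel_series_def kernel_term_def)

text \<open>The last bracket collects what does not depend on \<open>t\<close> after expanding \<open>(2 \<pi> t - \<pi>)\<^sup>2 / 4\<close>;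
  only the fact that it is constant matters below.\<close>

lemma kernel_series_2:
  assumes "0 < t" "t < 1"
  shows "kernel_series 2 t = of_real (- (t\<^sup>2 / 2 - t / 2) + (-1/8
    - (\<Sum>k. cos (real (Suc k) * pi) / (real (Suc k))\<^sup>2) / (2 * pi\<^sup>2)))"
proof -
  let ?F = "\<lambda>x. \<Sum>k. cos (real (Suc k) * x) / (real (Suc k))\<^sup>2"
  have "kernel_term 2 k t = of_real (- 1 / (2 * pi\<^sup>2) * (cos (real (Suc k) * (2 * pi * t)) / (real (Suc k))\<^sup>2))" for k
  proof -
    have "kernel_term 2 k t = of_real (2 * cos (freq k * t)) / of_real (- (freq k)\<^sup>2)"
      unfolding kernel_term_def by (simp add: complex_eq_iff power_mult_distrib del: of_nat_Suc)
    also have "\<dots> = of_real (2 * cos (freq k * t) / (- (freq k)\<^sup>2))"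
      by simp
    also have "2 * cos (freq k * t) / (- (freq k)\<^sup>2)
        = - 1 / (2 * pi\<^sup>2) * (cos (real (Suc k) * (2 * pi * t)) / (real (Suc k))\<^sup>2)"
      by (simp add: power_mult_distrib mult_ac del: of_nat_Suc)
    finally show ?thesis .
  qed
  then have "kernel_series 2 t = (\<Sum>k. of_real (- 1 / (2 * pi\<^sup>2) * (cos (real (Suc k) * (2 * pi * t)) / (real (Suc k))\<^sup>2)))"
    by (simp add: kernel_series_def)
  also have "\<dots> = of_real (- 1 / (2 * pi\<^sup>2) * ?F (2 * pi * t))"
    by (simp only: suminf_of_real[OF summable_mult[OF summable_cos_over_squares], symmetric]
        suminf_mult[OF summable_cos_over_squares])
  also have "?F (2 * pi * t) = (2 * pi * t - pi)\<^sup>2 / 4 + ?F pi"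
    using assms by (intro suminf_cos_over_squares) auto
  also have "- 1 / (2 * pi\<^sup>2) * ((2 * pi * t - pi)\<^sup>2 / 4 + ?F pi)
     = - (t\<^sup>2 / 2 - t / 2) + (-1/8 - ?F pi / (2 * pi\<^sup>2))"
  proof -
    have "- 1 / (2 * p\<^sup>2) * ((2 * p * t - p)\<^sup>2 / 4 + X)
     = - (t\<^sup>2 / 2 - t / 2) + (-1/8 - X / (2 * p\<^sup>2))" if "p \<noteq> 0" for p X :: real
      using that by (simp add: field_simps power2_eq_square)
    then show ?thesis by simp
  qed
  finally show ?thesis .
qed

section \<open>Kernels and Bernoulli polynomials\<close>

text \<open>This is the classical \<open>B\<^sub>n(x)\<close> divided by \<open>n!\<close>, the normalisation in which each polynomial is
  the derivative of the next one.\<close>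

definition bernoulli_poly :: "nat \<Rightarrow> real \<Rightarrow> real" where
  "bernoulli_poly n x = (\<Sum>j\<le>n. bernoulli j / fact j * (x ^ (n - j) / fact (n - j)))"

text \<open>Comparison of the coefficients of \<open>x\<^sup>n\<close> in the generating function identity.\<close>

lemma bernoulli_recurrence:
  "(\<Sum>j<n. bernoulli j / fact j / fact (n - j)) = (if n = 1 then 1 else 0)"
proof -
  have "(if n = 1 then 1 else 0) = fps_nth (Abs_fps (\<lambda>n. bernoulli n / fact n) * (fps_exp 1 - 1)) n"
    by (simp add: bernoulli_generating_function)
  also have "\<dots> = (\<Sum>j\<in>{0..n}. bernoulli j / fact j * (1 / fact (n - j) - (if n - j = 0 then 1 else 0)))"
    by (simp add: fps_mult_nth)
  also have "\<dots> = (\<Sum>j<n. bernoulli j / fact j / fact (n - j))"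
    by (rule sum.mono_neutral_cong_right) auto
  finally show ?thesis by simp
qed

lemma bernoulli_poly_0: "bernoulli_poly n 0 = bernoulli n / fact n"
proof -
  have "bernoulli_poly n 0 = (\<Sum>j\<in>{n}. bernoulli j / fact j * (0 ^ (n - j) / fact (n - j)))"
    unfolding bernoulli_poly_def by (rule sum.mono_neutral_right) auto
  then show ?thesis by simp
qed

lemma bernoulli_poly_1: "bernoulli_poly n 1 = bernoulli_poly n 0 + (if n = 1 then 1 else 0)"
  unfolding bernoulli_poly_0 bernoulli_recurrence[symmetric]
  by (simp add: bernoulli_poly_def lessThan_Suc_atMost[symmetric])

lemma has_derivative_bernoulli_poly:
  "(bernoulli_poly (Suc n) has_real_derivative bernoulli_poly n x) (at x within A)"
proof -
  have "((\<lambda>x. x ^ Suc m / fact (Suc m)) has_real_derivative x ^ m / fact m) (at x within A)" for m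
    by (rule derivative_eq_intros refl | simp del: of_nat_Suc)+
  then have "((\<lambda>x. x ^ (Suc n - j) / fact (Suc n - j)) has_real_derivative x ^ (n - j) / fact (n - j)) (at x within A)"
    if "j \<le> n" for j
    using that by (simp only: Suc_diff_le)
  then have "((\<lambda>x. (\<Sum>j\<le>n. bernoulli j / fact j * (x ^ (Suc n - j) / fact (Suc n - j)))
      + bernoulli (Suc n) / fact (Suc n)) has_real_derivative
      (\<Sum>j\<le>n. bernoulli j / fact j * (x ^ (n - j) / fact (n - j))) + 0) (at x within A)"
    by (intro DERIV_add DERIV_const DERIV_sum DERIV_cmult) auto
  then show ?thesis
    unfolding bernoulli_poly_def by (simp add: bernoulli_poly_def[abs_def] del: fact_Suc)
qed

lemma has_vector_derivative_bernoulli_poly: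
  "((\<lambda>x. of_real (bernoulli_poly (Suc n) x) :: complex)
     has_vector_derivative of_real (bernoulli_poly n x)) (at x within A)"
  by (rule has_vector_derivative_of_real)
     (use has_derivative_bernoulli_poly in \<open>simp add: has_real_derivative_iff_has_vector_derivative\<close>)

lemma bernoulli_poly_low:
  "bernoulli_poly 0 x = 1" "bernoulli_poly 1 x = x - 1/2"
  "bernoulli_poly 2 x = x\<^sup>2 / 2 - x / 2 + bernoulli 2 / 2"
proof -
  have b0: "bernoulli 0 = 1"
    using bernoulli_recurrence[of 1] by simp
  have b1: "bernoulli (Suc 0) = - 1/2"
    using bernoulli_recurrence[of 2] b0 by (simp add: numeral_2_eq_2)
  show "bernoulli_poly 0 x = 1" "bernoulli_poly 1 x = x - 1/2"
    by (simp_all add: bernoulli_poly_def b0 b1)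
  show "bernoulli_poly 2 x = x\<^sup>2 / 2 - x / 2 + bernoulli 2 / 2"
    by (simp add: bernoulli_poly_def b0 b1 numeral_2_eq_2)
qed

text \<open>The constant \<open>c\<close> is the mean over \<open>[0, 1]\<close> of the derivative of a function taking equal values
  at \<open>0\<close> and \<open>1\<close>, namely the same sum with \<open>n + 1\<close> in place of \<open>n\<close>.\<close>

lemma kernel_series_plus_bernoulli_poly_constant:
  assumes n: "n \<ge> 2" and c: "\<And>x. x \<in> {0..1} \<Longrightarrow> kernel_series n x + of_real (bernoulli_poly n x) = c"
  shows "c = 0"
proof -
  define g where "g x = kernel_series (Suc n) x + of_real (bernoulli_poly (Suc n) x)" for x
  have "((\<lambda>x. g x - x *\<^sub>R c) has_vector_derivative 0) (at x within {0..1})" if "x \<in> {0..1}" for x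
  proof -
    have "((\<lambda>x. g x - x *\<^sub>R c) has_vector_derivative
        kernel_series n x + of_real (bernoulli_poly n x) - 1 *\<^sub>R c) (at x within {0..1})"
      unfolding g_def
      by (intro has_vector_derivative_diff has_vector_derivative_add
          has_vector_derivative_at_within[OF has_vector_derivative_kernel_series[OF n]]
          has_vector_derivative_bernoulli_poly)
         (auto simp: has_vector_derivative_def intro!: derivative_eq_intros)
    then show ?thesis
      using c[OF that] by simp
  qed
  then obtain d where d: "\<And>x. x \<in> {0..1} \<Longrightarrow> g x - x *\<^sub>R c = d"
    using has_vector_derivative_zero_constant[of "{0..1}" "\<lambda>x. g x - x *\<^sub>R c"] by auto
  have "g 1 = g 0"
    unfolding g_def using kernel_series_add_of_nat[of "Suc n" 0 1] n by (simp add: bernoulli_poly_1)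
  then show "c = 0"
    using d[of 0] d[of 1] by simp
qed

text \<open>It is enough that the sum of both sides is constant. For \<open>n = 2\<close> this is the explicit quadratic
  polynomial found above, extended to the end points by continuity; from \<open>n\<close> to \<open>n + 1\<close> the
  derivative of the sum is the constant for \<open>n\<close>, which is zero.\<close>

lemma kernel_series_eq_bernoulli_poly:
  assumes "n \<ge> 2" "x \<in> {0..1}"
  shows "kernel_series n x = - of_real (bernoulli_poly n x)"
proof -
  have "\<exists>c. \<forall>x\<in>{0..1}. kernel_series n x + of_real (bernoulli_poly n x) = c"
    using assms(1)
  proof (induction n rule: nat_induct_at_least)
    case base
    define c :: complex where "c = of_real (-1/8 - (\<Sum>k. cos (real (Suc k) * pi) / (real (Suc k))\<^sup>2) / (2 * pi\<^sup>2)
      + bernoulli 2 / 2)"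
    have inner: "kernel_series 2 x + of_real (bernoulli_poly 2 x) = c" if "x \<in> {0<..<1}" for x
      using that unfolding c_def by (simp add: kernel_series_2 bernoulli_poly_low del: of_nat_Suc)
    have cont: "continuous_on A (\<lambda>x. kernel_series 2 x + of_real (bernoulli_poly 2 x))" for A
      unfolding bernoulli_poly_low by (intro continuous_intros continuous_on_kernel_series) auto
    have "kernel_series 2 x + of_real (bernoulli_poly 2 x) = c"
      if "x \<in> closure {0<..<1}" for x
      by (rule continuous_constant_on_closure[OF cont inner that])
    then show ?case by auto
  next
    case (Suc n)
    then obtain c where c: "\<And>x. x \<in> {0..1} \<Longrightarrow> kernel_series n x + of_real (bernoulli_poly n x) = c"
      by blast
    then have "c = 0"
      by (rule kernel_series_plus_bernoulli_poly_constant[OF Suc.hyps])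
    then have "((\<lambda>x. kernel_series (Suc n) x + of_real (bernoulli_poly (Suc n) x))
        has_vector_derivative 0) (at x within {0..1})" if "x \<in> {0..1}" for x
      using has_vector_derivative_add[OF
          has_vector_derivative_at_within[OF has_vector_derivative_kernel_series[OF Suc.hyps]]
          has_vector_derivative_bernoulli_poly[of n x "{0..1}"]] c[OF that] by simp
    then obtain d where "\<And>x. x \<in> {0..1} \<Longrightarrow>
        kernel_series (Suc n) x + of_real (bernoulli_poly (Suc n) x) = d"
      using has_vector_derivative_zero_constant[OF convex_real_interval(5)] by blast
    then show ?case by blast
  qed
  then obtain c where c: "\<And>x. x \<in> {0..1} \<Longrightarrow> kernel_series n x + of_real (bernoulli_poly n x) = c"
    by blast
  then have "c = 0"
    by (rule kernel_series_plus_bernoulli_poly_constant[OF assms(1)])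
  with c[OF assms(2)] show ?thesis
    by (simp add: eq_neg_iff_add_eq_0)
qed

lemma periodic_kernel_eq_kernel_series:
  assumes n: "n \<ge> 2"
  shows "periodic_kernel n t = kernel_series n t * indicator {0..} t"
proof -
  define g where "g k = exp (2 * pi * \<i> * of_int k * t) / (2 * pi * \<i> * of_int k) ^ n" for k :: int
  define pos neg where "pos k = int (Suc k)" and "neg k = - int (Suc k)" for k
  have inj: "inj pos" "inj neg"
    by (auto simp: inj_def pos_def neg_def)
  have split: "UNIV - {0} = range pos \<union> range neg" and disj: "range pos \<inter> range neg = {}"
  proof -
    show "range pos \<inter> range neg = {}"
      by (auto simp: pos_def neg_def)
    have "k \<in> range pos \<union> range neg" if "k \<noteq> 0" for k
    proof (cases "k > 0")
      case True
      then have "k = pos (nat (k - 1))" by (simp add: pos_def)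
      then show ?thesis by blast
    next
      case False
      with that have "k = neg (nat (- k - 1))" by (simp add: neg_def)
      then show ?thesis by blast
    qed
    then show "UNIV - {0} = range pos \<union> range neg"
      by (auto simp: pos_def neg_def)
  qed
  have g_pos: "g (pos k) = cis (freq k * t) / (\<i> * of_real (freq k)) ^ n" for k
    by (simp add: g_def pos_def cis_conv_exp mult_ac)
  have g_neg: "g (neg k) = (-1) ^ n * cis (- (freq k * t)) / (\<i> * of_real (freq k)) ^ n" for k
  proof -
    have base: "2 * pi * \<i> * of_int (neg k) = - (\<i> * of_real (freq k))"
      and arg: "2 * pi * \<i> * of_int (neg k) * t = \<i> * of_real (- (freq k * t))"
      by (simp_all add: neg_def algebra_simps)
    have "e / (- z) ^ n = (-1) ^ n * e / z ^ n" for e z :: complex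
      by (cases "even n") auto
    then show ?thesis
      unfolding g_def cis_conv_exp arg unfolding base .
  qed
  have norm_g: "norm (g (pos k)) \<le> 1 / (real (Suc k))\<^sup>2" "norm (g (neg k)) \<le> 1 / (real (Suc k))\<^sup>2" for k
    unfolding g_pos g_neg using inverse_freq_power_le[OF n, of k]
    by (simp_all add: norm_divide norm_mult norm_power del: of_nat_Suc)
  have abs: "summable (\<lambda>k. norm (g (pos k)))" "summable (\<lambda>k. norm (g (neg k)))"
    by (rule summable_comparison_test'[OF summable_inverse_Suc_squares],
        unfold real_norm_def abs_norm_cancel, rule norm_g)+
  have sums: "(g has_sum (\<Sum>k. g (pos k))) (range pos)" "(g has_sum (\<Sum>k. g (neg k))) (range neg)"
    by (subst has_sum_reindex[OF inj(1)] has_sum_reindex[OF inj(2)], unfold o_def,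
        rule norm_summable_imp_has_sum[OF abs(1) summable_sums[OF summable_norm_cancel[OF abs(1)]]]
          norm_summable_imp_has_sum[OF abs(2) summable_sums[OF summable_norm_cancel[OF abs(2)]]])+
  have "(\<Sum>\<^sub>\<infinity>k\<in>UNIV - {0}. g k) = (\<Sum>k. g (pos k)) + (\<Sum>k. g (neg k))"
    unfolding split by (rule infsumI[OF has_sum_Un_disjoint[OF sums disj]])
  also have "\<dots> = (\<Sum>k. g (pos k) + g (neg k))"
    by (rule suminf_add[OF summable_norm_cancel[OF abs(1)] summable_norm_cancel[OF abs(2)]])
  also have "\<dots> = kernel_series n t"
    unfolding kernel_series_def kernel_term_def g_pos g_neg add_divide_distrib[symmetric] ..
  finally show ?thesis
    unfolding periodic_kernel_def g_def by simp
qed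

section \<open>The Euler-Maclaurin formula\<close>

text \<open>On \<open>[N, N + 1]\<close> the kernel is a quadratic polynomial, so two integrations by parts are possible.
  The jump of \<open>B\<^sub>1(t - N) = t - N - 1/2\<close> from \<open>1/2\<close> to \<open>-1/2\<close> at each integer produces the values of
  \<open>D 0\<close> there, while the boundary terms with \<open>D 1\<close> telescope. Here and below \<open>D k\<close> stands for the
  \<open>k\<close>-th derivative of one function.\<close>

lemma euler_maclaurin_order_2:
  assumes D: "\<And>k t. (D k has_vector_derivative D (Suc k) t) (at t)"
  shows "((\<lambda>t. kernel_series 2 t * D 2 t + D 0 t) has_integral
    (\<Sum>j<N. D 0 (real j)) - D 0 0 / 2 + D 0 (real N) / 2
      - of_real (bernoulli 2 / 2) * (D 1 (real N) - D 1 0)) {0..real N}"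
proof (induction N)
  case 0
  then show ?case using has_integral_refl(2)[of _ 0] by simp
next
  case (Suc N)
  let ?b = "of_real (bernoulli 2 / 2) :: complex"
  define B where "B n t = (of_real (bernoulli_poly n (t - real N)) :: complex)" for n t
  define G where "G t = B 1 t * D 0 t - B 2 t * D 1 t" for t
  have B: "(B (Suc n) has_vector_derivative B n t) (at t within A)" for n t A
  proof -
    have "((\<lambda>t. t - real N) has_real_derivative 1) (at t within A)"
      by (auto intro!: derivative_eq_intros)
    then have "((\<lambda>t. bernoulli_poly (Suc n) (t - real N)) has_real_derivative
        bernoulli_poly n (t - real N) * 1) (at t within A)"
      by (rule DERIV_chain2[OF has_derivative_bernoulli_poly])
    then show ?thesis
      unfolding B_def
      by (intro has_vector_derivative_of_real) (simp add: has_real_derivative_iff_has_vector_derivative)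
  qed
  have "(G has_vector_derivative D 0 t - B 2 t * D 2 t) (at t within A)" for t A
  proof -
    have "(G has_vector_derivative
        (B 1 t * D (Suc 0) t + B 0 t * D 0 t) - (B 2 t * D (Suc 1) t + B 1 t * D 1 t)) (at t within A)"
      unfolding G_def
      by (intro has_vector_derivative_diff has_vector_derivative_mult
          has_vector_derivative_at_within[OF D] B[of 0, simplified One_nat_def[symmetric]]
          B[of 1, simplified Suc_1])
    then show ?thesis
      by (simp add: B_def bernoulli_poly_low numeral_2_eq_2)
  qed
  then have ftc: "((\<lambda>t. D 0 t - B 2 t * D 2 t) has_integral G (real (Suc N)) - G (real N)) {real N..real (Suc N)}"
    by (intro fundamental_theorem_of_calculus) auto
  have integrand: "D 0 t - B 2 t * D 2 t = kernel_series 2 t * D 2 t + D 0 t" if "t \<in> {real N..real (Suc N)}" for t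
  proof -
    have "kernel_series 2 t = - B 2 t"
      using kernel_series_add_of_nat[of 2 "t - real N" N]
        kernel_series_eq_bernoulli_poly[of 2 "t - real N"] that by (simp add: B_def)
    then show ?thesis by simp
  qed
  have "G (real (Suc N)) - G (real N)
      = (D 0 (real N) + D 0 (real (Suc N))) / 2 - ?b * (D 1 (real (Suc N)) - D 1 (real N))"
  proof -
    have "G (real (Suc N)) = D 0 (real (Suc N)) / 2 - ?b * D 1 (real (Suc N))"
      "G (real N) = - D 0 (real N) / 2 - ?b * D 1 (real N)"
      unfolding G_def B_def by (simp_all add: bernoulli_poly_low(3) bernoulli_poly_low(2)[unfolded One_nat_def])
    then show ?thesis
      by (simp only: right_diff_distrib add_divide_distrib) (simp del: of_nat_Suc)
  qed
  with has_integral_eq[OF integrand ftc] have "((\<lambda>t. kernel_series 2 t * D 2 t + D 0 t) has_integral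
      (D 0 (real N) + D 0 (real (Suc N))) / 2 - ?b * (D 1 (real (Suc N)) - D 1 (real N))) {real N..real (Suc N)}"
    by (simp only:)
  from has_integral_combine[OF _ _ Suc this] show ?case
    by (simp add: algebra_simps add_divide_distrib)
qed

text \<open>From the third kernel on, the kernels are differentiable on the whole line, so a single
  integration by parts covers \<open>[0, R]\<close> and leaves a boundary term at \<open>0\<close> only.\<close>

lemma kernel_series_integration_by_parts:
  assumes D: "\<And>k t. (D k has_vector_derivative D (Suc k) t) (at t)"
    and van: "\<And>k t. t \<ge> real R \<Longrightarrow> D k t = 0" and n: "n \<ge> 2"
  shows "integral {0..real R} (\<lambda>t. kernel_series (Suc n) t * D (Suc n) t)
    = - integral {0..real R} (\<lambda>t. kernel_series n t * D n t) - kernel_series (Suc n) 0 * D n 0"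
proof -
  have cont: "continuous_on A (D k)" for A k
    using D continuous_on_vector_derivative has_vector_derivative_at_within by blast
  have int: "(\<lambda>t. kernel_series k t * D k t) integrable_on {0..real R}" if "k \<ge> 2" for k
    by (intro integrable_continuous_real continuous_intros continuous_on_kernel_series cont that)
  have "((\<lambda>t. kernel_series (Suc n) t * D n t) has_vector_derivative
      kernel_series (Suc n) t * D (Suc n) t + kernel_series n t * D n t) (at t within {0..real R})" for t
    by (intro has_vector_derivative_mult has_vector_derivative_at_within[OF D]
        has_vector_derivative_at_within[OF has_vector_derivative_kernel_series[OF n]])
  then have "((\<lambda>t. kernel_series (Suc n) t * D (Suc n) t + kernel_series n t * D n t) has_integral
      kernel_series (Suc n) (real R) * D n (real R) - kernel_series (Suc n) 0 * D n 0) {0..real R}"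
    by (intro fundamental_theorem_of_calculus) auto
  then have "integral {0..real R} (\<lambda>t. kernel_series (Suc n) t * D (Suc n) t + kernel_series n t * D n t)
      = - kernel_series (Suc n) 0 * D n 0"
    using van[of "real R" n] by (simp add: integral_unique)
  moreover have "integral {0..real R} (\<lambda>t. kernel_series (Suc n) t * D (Suc n) t + kernel_series n t * D n t)
      = integral {0..real R} (\<lambda>t. kernel_series (Suc n) t * D (Suc n) t)
        + integral {0..real R} (\<lambda>t. kernel_series n t * D n t)"
    using n by (intro integral_add int) auto
  moreover have "a = - b - c * d" if "s = - c * d" "s = a + b" for a b c d s :: complex
    using that by (simp add: algebra_simps) (metis add.commute add_diff_cancel_right' uminus_add_conv_diff)
  ultimately show ?thesis
    by blast
qed

text \<open>Each step from \<open>m\<close> to \<open>m + 1\<close> integrates by parts twice: the first boundary term has an odd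
  kernel at \<open>0\<close> and vanishes, the second one carries \<open>- B\<^sub>2\<^sub>m\<^sub>+\<^sub>2 / (2m + 2)!\<close>, the value of the even
  kernel at \<open>0\<close>.\<close>

lemma euler_maclaurin:
  assumes D: "\<And>k t. (D k has_vector_derivative D (Suc k) t) (at t)"
    and van: "\<And>k t. t \<ge> real R \<Longrightarrow> D k t = 0" and m: "m \<ge> 1"
  shows "(\<Sum>j<R. D 0 (real j)) = D 0 0 / 2 + integral {0..real R} (D 0)
    - (\<Sum>l=1..m. of_real (bernoulli (2 * l) / fact (2 * l)) * D (2 * l - 1) 0)
    + integral {0..real R} (\<lambda>t. kernel_series (2 * m) t * D (2 * m) t)"
  using m
proof (induction m rule: nat_induct_at_least)
  case base
  have cont: "continuous_on A (D k)" for A k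
    using D continuous_on_vector_derivative has_vector_derivative_at_within by blast
  have split: "integral {0..real R} (\<lambda>t. kernel_series 2 t * D 2 t + D 0 t)
      = integral {0..real R} (\<lambda>t. kernel_series 2 t * D 2 t) + integral {0..real R} (D 0)"
    by (intro integral_add integrable_continuous_real continuous_intros continuous_on_kernel_series cont) simp
  have total: "integral {0..real R} (\<lambda>t. kernel_series 2 t * D 2 t + D 0 t)
      = (\<Sum>j<R. D 0 (real j)) - D 0 0 / 2 + of_real (bernoulli 2 / 2) * D 1 0"
    using integral_unique[OF euler_maclaurin_order_2[of D R, OF D]] van by simp
  have rearrange: "S = h + y - b + x" if "z = x + y" "z = S - h + b" for S h x y z b :: complex
    using that by (simp add: algebra_simps)
  have sum_1: "(\<Sum>l=1..1. of_real (bernoulli (2 * l) / fact (2 * l)) * D (2 * l - 1) 0)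
      = of_real (bernoulli 2 / 2) * D 1 0"
    by (simp add: numeral_2_eq_2)
  show ?case
    unfolding sum_1 mult_1_right by (rule rearrange[OF split total])
next
  case (Suc m)
  let ?I = "\<lambda>n. integral {0..real R} (\<lambda>t. kernel_series n t * D n t)"
  let ?b = "of_real (bernoulli (2 * Suc m) / fact (2 * Suc m)) :: complex"
  have ind: "2 * Suc m = Suc (Suc (2 * m))" "2 * Suc m - 1 = Suc (2 * m)"
    by simp_all
  have "?I (2 * Suc m) = - ?I (Suc (2 * m)) - kernel_series (2 * Suc m) 0 * D (2 * Suc m - 1) 0"
    unfolding ind(2) unfolding ind(1) by (rule kernel_series_integration_by_parts[of D R, OF D van]) (use Suc.hyps in auto)
  also have "?I (Suc (2 * m)) = - ?I (2 * m) - kernel_series (Suc (2 * m)) 0 * D (2 * m) 0"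
    by (rule kernel_series_integration_by_parts[of D R, OF D van]) (use Suc.hyps in auto)
  also have "kernel_series (Suc (2 * m)) 0 = 0"
    by (rule kernel_series_odd_0) simp
  also have "kernel_series (2 * Suc m) 0 = - ?b"
    using kernel_series_eq_bernoulli_poly[of "2 * Suc m" 0] by (simp only: bernoulli_poly_0) simp
  finally have step: "?I (2 * Suc m) = ?I (2 * m) + ?b * D (2 * Suc m - 1) 0"
    by simp
  have sum_Suc: "(\<Sum>l=1..Suc m. of_real (bernoulli (2 * l) / fact (2 * l)) * D (2 * l - 1) 0)
      = (\<Sum>l=1..m. of_real (bernoulli (2 * l) / fact (2 * l)) * D (2 * l - 1) 0) + ?b * D (2 * Suc m - 1) 0"
    by (subst sum.cl_ivl_Suc, subst if_not_P) auto
  have "A - S + I = A - (S + b) + (I + b)" for A S I b :: complex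
    by simp
  then show ?case
    unfolding sum_Suc step Suc.IH .
qed

section \<open>Testing the distributions\<close>

lemma has_vector_derivative_tf:
  "((vderiv ^^ k) (tf_app \<phi>) has_vector_derivative (vderiv ^^ Suc k) (tf_app \<phi>) t) (at t)"
  using smooth_differentiable[OF smooth_funpow_vderiv[OF smooth_tf]]
  by (simp add: vderiv_def vector_derivative_works)

lemma funpow_vderiv_tf_eventually_0:
  obtains R :: nat where "\<And>k t. t \<ge> real R \<Longrightarrow> (vderiv ^^ k) (tf_app \<phi>) t = 0"
proof -
  have "bounded (supp (tf_app \<phi>))"
    using compact_supp_tf by (rule compact_imp_bounded)
  then obtain a where a: "\<And>t. t \<in> supp (tf_app \<phi>) \<Longrightarrow> \<bar>t\<bar> \<le> a"
    unfolding bounded_iff by auto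
  obtain R :: nat where R: "a < real R"
    using reals_Archimedean2 by blast
  have "supp ((vderiv ^^ k) (tf_app \<phi>)) \<subseteq> supp (tf_app \<phi>)" for k
    by (induction k) (use compact_supp_vderiv(2) in auto)
  then have "(vderiv ^^ k) (tf_app \<phi>) t = 0" if "t \<ge> real R" for k t
    using that a[of t] R closure_subset[of "{t. (vderiv ^^ k) (tf_app \<phi>) t \<noteq> 0}"]
    unfolding supp_def by force
  then show thesis by (rule that)
qed

lemma pairing_funpow_dist_deriv:
  "pairing ((dist_deriv ^^ n) u) \<phi> = (-1) ^ n * pairing u ((tf_deriv ^^ n) \<phi>)"
proof (induction n arbitrary: \<phi>)
  case (Suc n)
  then show ?case
    by (simp add: dist_deriv.rep_eq funpow_swap1[of tf_deriv])
qed simp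

lemma set_integrable_lebesgue_compact:
  fixes h :: "real \<Rightarrow> complex"
  assumes "continuous_on UNIV h" "compact S"
  shows "set_integrable lebesgue S h"
proof -
  have "integrable lborel (\<lambda>x. indicator S x *\<^sub>R h x)"
    using assms by (intro borel_integrable_compact) (auto intro: continuous_on_subset)
  then show ?thesis
    unfolding set_integrable_def by (simp add: integrable_completion borel_measurable_integrable)
qed

lemma pairing_regular_dist_half_line:
  assumes h: "continuous_on UNIV h" and van: "\<And>t. t \<ge> real R \<Longrightarrow> tf_app \<phi> t = 0"
  shows "pairing (regular_dist (\<lambda>t. h t * indicator {0..} t)) \<phi>
    = integral {0..real R} (\<lambda>t. h t * tf_app \<phi> t)"
proof -
  have "set_integrable lebesgue C (\<lambda>t. h t * indicator {0..} t)" if "compact C" for C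
  proof -
    have "set_integrable lebesgue (C \<inter> {0..}) h"
      by (intro set_integrable_lebesgue_compact h compact_Int_closed that closed_atLeast)
    moreover have "indicat_real (C \<inter> {0..}) t *\<^sub>R h t = indicat_real C t *\<^sub>R (h t * indicator {0..} t)" for t
      by (simp add: indicator_def)
    ultimately show ?thesis
      unfolding set_integrable_def by simp
  qed
  then have "locally_integrable (\<lambda>t. h t * indicator {0..} t)"
    by (simp add: locally_integrable_def)
  then have "pairing (regular_dist (\<lambda>t. h t * indicator {0..} t)) \<phi>
      = (LINT t|lebesgue. (h t * indicator {0..} t) * tf_app \<phi> t)"
    by (simp add: regular_dist.rep_eq)
  also have "\<dots> = (LINT t:{0..real R}|lebesgue. h t * tf_app \<phi> t)"
    unfolding set_lebesgue_integral_def
    by (rule Bochner_Integration.integral_cong) (use van in \<open>auto simp: indicator_def\<close>)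
  also have "\<dots> = integral {0..real R} (\<lambda>t. h t * tf_app \<phi> t)"
  proof (rule set_lebesgue_integral_eq_integral(2), rule set_integrable_lebesgue_compact)
    have "continuous_on UNIV (tf_app \<phi>)"
      using has_vector_derivative_tf[of 0 \<phi>]
      by (intro continuous_on_vector_derivative) auto
    then show "continuous_on UNIV (\<lambda>t. h t * tf_app \<phi> t)"
      by (intro continuous_intros h)
  qed simp
  finally show ?thesis .
qed

theorem theorem5p3:
  fixes m :: nat
  assumes "m \<ge> 1"
  shows "(\<lambda>n. dirac (real n)) sums
    ((1 / 2) *\<^sub>R dirac 0 + regular_dist (indicator {0..})
      + (\<Sum>l=1..m. (bernoulli (2 * l) / fact (2 * l)) *\<^sub>R (dist_deriv ^^ (2 * l - 1)) (dirac 0))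
      + (dist_deriv ^^ (2 * m)) (regular_dist (periodic_kernel (2 * m))))"
  unfolding sums_distribution_iff
proof
  fix \<phi>
  define D where "D k = (vderiv ^^ k) (tf_app \<phi>)" for k
  have D: "(D k has_vector_derivative D (Suc k) t) (at t)" for k t
    unfolding D_def by (rule has_vector_derivative_tf)
  obtain R :: nat where van: "\<And>k t. t \<ge> real R \<Longrightarrow> D k t = 0"
    unfolding D_def using funpow_vderiv_tf_eventually_0 by blast
  have D_app: "tf_app ((tf_deriv ^^ k) \<phi>) = D k" for k
    by (simp add: D_def tf_app_funpow_deriv)
  have D_0: "tf_app \<phi> = D 0"
    by (simp add: D_def)
  have heaviside: "pairing (regular_dist (indicator {0..})) \<phi> = integral {0..real R} (D 0)"
    using pairing_regular_dist_half_line[of "\<lambda>_. 1" R \<phi>] van by (simp add: D_0)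
  have kernel: "pairing ((dist_deriv ^^ (2 * m)) (regular_dist (periodic_kernel (2 * m)))) \<phi>
      = integral {0..real R} (\<lambda>t. kernel_series (2 * m) t * D (2 * m) t)"
  proof -
    have "periodic_kernel (2 * m) = (\<lambda>t. kernel_series (2 * m) t * indicator {0..} t)"
      using assms by (intro ext periodic_kernel_eq_kernel_series) simp
    then show ?thesis
      using pairing_regular_dist_half_line[of "kernel_series (2 * m)" R "(tf_deriv ^^ (2 * m)) \<phi>"]
        continuous_on_kernel_series[of "2 * m"] van assms
      by (simp add: pairing_funpow_dist_deriv D_app)
  qed
  have deltas: "pairing (\<Sum>l=1..m. (bernoulli (2 * l) / fact (2 * l)) *\<^sub>R (dist_deriv ^^ (2 * l - 1)) (dirac 0)) \<phi>
      = - (\<Sum>l=1..m. of_real (bernoulli (2 * l) / fact (2 * l)) * D (2 * l - 1) 0)"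
    unfolding pairing_sum sum_negf[symmetric]
  proof (rule sum.cong)
    fix l assume "l \<in> {1..m}"
    then have "odd (2 * l - 1)" by simp
    then show "pairing ((bernoulli (2 * l) / fact (2 * l)) *\<^sub>R (dist_deriv ^^ (2 * l - 1)) (dirac 0)) \<phi>
        = - (of_real (bernoulli (2 * l) / fact (2 * l)) * D (2 * l - 1) 0)"
      by (simp only: pairing_scaleR pairing_funpow_dist_deriv dirac.rep_eq D_app) simp
  qed simp
  have "(\<lambda>n. pairing (dirac (real n)) \<phi>) sums (\<Sum>j<R. D 0 (real j))"
    unfolding dirac.rep_eq D_0 by (intro sums_finite) (use van in auto)
  also have "(\<Sum>j<R. D 0 (real j)) = pairing ((1 / 2) *\<^sub>R dirac 0 + regular_dist (indicator {0..})
      + (\<Sum>l=1..m. (bernoulli (2 * l) / fact (2 * l)) *\<^sub>R (dist_deriv ^^ (2 * l - 1)) (dirac 0))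
      + (dist_deriv ^^ (2 * m)) (regular_dist (periodic_kernel (2 * m)))) \<phi>"
    using euler_maclaurin[of D R m, OF D van assms]
    unfolding pairing_add heaviside kernel deltas pairing_scaleR dirac.rep_eq D_0 by simp
  finally show "(\<lambda>n. pairing (dirac (real n)) \<phi>) sums pairing ((1 / 2) *\<^sub>R dirac 0
      + regular_dist (indicator {0..})
      + (\<Sum>l=1..m. (bernoulli (2 * l) / fact (2 * l)) *\<^sub>R (dist_deriv ^^ (2 * l - 1)) (dirac 0))
      + (dist_deriv ^^ (2 * m)) (regular_dist (periodic_kernel (2 * m)))) \<phi>" .
qed

end
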